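(* Let $\pi=\prod_{j=1}^{m}t_{k_{j}}^{i_{k_{j}}}\in S_n$ ($m\ge 1$) be a standard OGS elementary element, presented in the standard OGS canonical form with $2\le k_1<k_2<\cdots<k_m\le n$ and $0<i_{k_j}<k_j$ for every $1\leq j\leq m$, and let $\rho_j=\sum_{x=j}^{m}i_{k_x}$ for $1\le j\le m$. Then: (1) $$\pi=\begin{cases} t_{k_{1}}^{\rho_{1}}\cdot (t_{k_{1}}^{k_{1}-\rho_{2}} t_{k_{2}}^{\rho_{2}})\cdot (t_{k_{2}}^{k_{2}-\rho_{3}} t_{k_{3}}^{\rho_{3}})\cdots (t_{k_{m-1}}^{k_{m-1}-\rho_{m}} t_{k_{m}}^{\rho_{m}}) & \text{if } k_{1}>\rho_{1}, \\ (t_{k_{1}}^{k_{1}-\rho_{2}} t_{k_{2}}^{\rho_{2}})\cdot (t_{k_{2}}^{k_{2}-\rho_{3}} t_{k_{3}}^{\rho_{3}})\cdots (t_{k_{m-1}}^{k_{m-1}-\rho_{m}} t_{k_{m}}^{\rho_{m}}) & \text{if } k_{1}=\rho_{1}.\end{cases}$$ (2) $$norm(\pi)=\prod_{u=\rho_1}^{k_1-1}\prod_{r=0}^{\rho_1-1}s_{u-r}\cdot \prod_{u=k_1}^{k_2-1}\prod_{r=0}^{\rho_2-1}s_{u-r}\cdot \prod_{u=k_2}^{k_3-1}\prod_{r=0}^{\rho_3-1}s_{u-r}\cdots \prod_{u=k_{m-1}}^{k_m-1}\prod_{r=0}^{\rho_m-1}s_{u-r}.$$ (3) $$\ell(\pi)=\sum_{j=1}^{m}k_{j}\,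 i_{k_{j}}-(i_{k_{1}}+i_{k_{2}}+\cdots +i_{k_{m}})^{2}=\sum_{j=1}^{m}k_{j}\, i_{k_{j}}-\left(maj(\pi)\right)^{2}.$$ (4) Every non-empty sub-word of $\pi$ is a standard OGS elementary element too. In particular, for every two non-empty sub-words $\pi_1,\pi_2$ of $\pi$ such that $\pi$ is the concatenation $\pi_1\cdot\pi_2$, one has $\ell(\pi)=\ell(\pi_1\cdot\pi_2)<\ell(\pi_1)+\ell(\pi_2)$. (5) For every $1\le r\le n-1$, $$\ell(s_r\cdot \pi)=\begin{cases} \ell(\pi)-1 & \text{if } r=\sum_{j=1}^{m}i_{k_{j}}, \\ \ell(\pi)+1 & \text{if } r\neq \sum_{j=1}^{m}i_{k_{j}},\end{cases}$$ i.e. $des(\pi)$ contains just one element: $des(\pi)=\{maj(\pi)\}$.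
   Context: $S_n$ is the group of permutations of $\{1,\dots,n\}$, with products taken from left to right: $(\pi_1\cdot\pi_2)(i)=\pi_2(\pi_1(i))$. $s_i$ is the transposition $(i,i+1)$, $1\le i\le n-1$; $\ell(\pi)$ is the Coxeter length with respect to $s_1,\dots,s_{n-1}$ (the number of inversions of $\pi$). $des(\pi)=\{1\le i\le n-1: \pi(i)>\pi(i+1)\}$ and $maj(\pi)=\sum_{i\in des(\pi)}i$. For $2\le m\le n$, $t_m=s_1s_2\cdots s_{m-1}$. Every element of $S_n$ has a unique presentation $t_2^{i_2}t_3^{i_3}\cdots t_n^{i_n}$ with $0\le i_k<k$ (the standard OGS canonical form); one often writes only the factors with non-zero exponent. By a theorem of Adin and Roichman, $maj(\pi)$ equals the sum of the exponents in this form. An element $\pi=\prod_{j=1}^m t_{k_j}^{i_{k_j}}$ in this form, with $k_1<\cdots<k_m$ and all $i_{k_j}>0$, is called a standard OGS elementary element if $\sum_{j=1}^m i_{k_j}\le k_1$. $norm(\pi)$ denotes the normal form of $\pi$: the unique reduced word for $\pi$ of the form $\prod_{u=1}^{n-1}\prod_{r=0}^{y_u-1}s_{u-r}$ with $0\le y_u\le u$ (products are expanded from left to right in increasing order of the index; empty products are empty words). A sub-word of $\pi$ means a segment of consecutive letters of the word obtained by writing out the canonical form of $\pi$ as $t_{k_1}\cdots t_{k_1}\,t_{k_2}\cdots t_{k_2}\cdots t_{k_m}\cdots t_{k_m}$ (with $t_{k_j}$ repeated $i_{k_j}$ times), regarded also as an element of $S_n$. *)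

theory Defs
  imports "HOL-Combinatorics.Permutations" "HOL-Library.Sublist"
begin

(* S_n is the set of functions p with "p permutes {1..n}". Products are read from left to right,
   i.e. opposite to function composition; powers are therefore plain iterates p ^^ a. *)

definition lr_mult :: "(nat \<Rightarrow> nat) \<Rightarrow> (nat \<Rightarrow> nat) \<Rightarrow> nat \<Rightarrow> nat"  (infixl "\<odot>" 70)
  where "p \<odot> q = (\<lambda>x. q (p x))"

definition lr_prod :: "(nat \<Rightarrow> nat) list \<Rightarrow> nat \<Rightarrow> nat"
  where "lr_prod ps = foldr (\<odot>) ps id"

definition adj :: "nat \<Rightarrow> nat \<Rightarrow> nat"
  where "adj i = transpose i (i + 1)"

(* A word in the Coxeter generators is the list of the indices of its letters. *)
definition word_perm :: "nat list \<Rightarrow> nat \<Rightarrow> nat"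
  where "word_perm w = lr_prod (map adj w)"

definition coxeter_length :: "nat \<Rightarrow> (nat \<Rightarrow> nat) \<Rightarrow> nat"
  where "coxeter_length n p =
    (LEAST l. \<exists>w. set w \<subseteq> {1..<n} \<and> word_perm w = p \<and> length w = l)"

definition reduced_word :: "nat \<Rightarrow> (nat \<Rightarrow> nat) \<Rightarrow> nat list \<Rightarrow> bool"
  where "reduced_word n p w \<longleftrightarrow>
    set w \<subseteq> {1..<n} \<and> word_perm w = p \<and> length w = coxeter_length n p"

(* The word prod_{u=a}^{b-1} prod_{r=0}^{y u - 1} s_{u-r}. *)
definition staircase :: "nat \<Rightarrow> nat \<Rightarrow> (nat \<Rightarrow> nat) \<Rightarrow> nat list"
  where "staircase a b y = concat (map (\<lambda>u. map (\<lambda>r. u - r) [0..<y u]) [a..<b])"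

definition normal_form :: "nat \<Rightarrow> (nat \<Rightarrow> nat) \<Rightarrow> nat list"
  where "normal_form n p =
    (THE w. reduced_word n p w \<and> (\<exists>y. (\<forall>u\<in>{1..<n}. y u \<le> u) \<and> w = staircase 1 n y))"

definition descents :: "nat \<Rightarrow> (nat \<Rightarrow> nat) \<Rightarrow> nat set"
  where "descents n p = {i. 1 \<le> i \<and> i < n \<and> p i > p (i + 1)}"

definition maj :: "nat \<Rightarrow> (nat \<Rightarrow> nat) \<Rightarrow> nat"
  where "maj n p = \<Sum> (descents n p)"

definition ogs_gen :: "nat \<Rightarrow> nat \<Rightarrow> nat"
  where "ogs_gen k = word_perm [1..<k]"

(* p = t_{k_1}^{i_{k_1}} ... t_{k_m}^{i_{k_m}} is the standard OGS canonical form of p in S_n.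
   As in the usual notation, the exponents are indexed by the k_j: i_{k_j} is "i (k j)". *)
definition ogs_form ::
    "nat \<Rightarrow> nat \<Rightarrow> (nat \<Rightarrow> nat) \<Rightarrow> (nat \<Rightarrow> nat) \<Rightarrow> (nat \<Rightarrow> nat) \<Rightarrow> bool"
  where "ogs_form n m k i p \<longleftrightarrow>
    p permutes {1..n} \<and>
    strict_mono_on {1..m} k \<and>
    (\<forall>j\<in>{1..m}. 2 \<le> k j \<and> k j \<le> n \<and> 0 < i (k j) \<and> i (k j) < k j) \<and>
    p = lr_prod (map (\<lambda>j. ogs_gen (k j) ^^ i (k j)) [1..<m+1])"

definition ogs_elementary_form ::
    "nat \<Rightarrow> nat \<Rightarrow> (nat \<Rightarrow> nat) \<Rightarrow> (nat \<Rightarrow> nat) \<Rightarrow> (nat \<Rightarrow> nat) \<Rightarrow> bool"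
  where "ogs_elementary_form n m k i p \<longleftrightarrow>
    1 \<le> m \<and> ogs_form n m k i p \<and> (\<Sum>j=1..m. i (k j)) \<le> k 1"

definition ogs_elementary :: "nat \<Rightarrow> (nat \<Rightarrow> nat) \<Rightarrow> bool"
  where "ogs_elementary n p \<longleftrightarrow> (\<exists>m k i. ogs_elementary_form n m k i p)"

(* The letter t_k of a word in the OGS generators is represented by k. *)
definition ogs_word :: "nat \<Rightarrow> (nat \<Rightarrow> nat) \<Rightarrow> (nat \<Rightarrow> nat) \<Rightarrow> nat list"
  where "ogs_word m k i = concat (map (\<lambda>j. replicate (i (k j)) (k j)) [1..<m+1])"

definition ogs_word_perm :: "nat list \<Rightarrow> nat \<Rightarrow> nat"
  where "ogs_word_perm w = lr_prod (map ogs_gen w)"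

definition rho :: "nat \<Rightarrow> (nat \<Rightarrow> nat) \<Rightarrow> (nat \<Rightarrow> nat) \<Rightarrow> nat \<Rightarrow> nat"
  where "rho m k i j = (\<Sum>x=j..m. i (k x))"

end

theory Submission imports Defs begin

text \<open>
  The proof reads the canonical form as a word w in the letters t_k, repetitions written out, and
  reasons about the map that w defines on positions. The letter t_k sends 1 to k and lowers
  2, ..., k by one. Let d = \<open>length w\<close>, which is \<open>rho 1\<close>. Elementarity says that d is at most every
  letter of w. So if x \<open>\<le>\<close> d, the first x - 1 letters bring x down to 1, the x-th letter a lifts the 1
  to a, and each of the d - x letters after it, all of them at least a, lowers the value by one
  again. Hence x is sent to x + a - d (\<open>ogs_word_perm_low\<close>), which increases with x because
  w is sorted. Past d the map is increasing as well (\<open>ogs_word_perm_high\<close>).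

  The permutation is thus Grassmannian with d as its only possible descent. The descent does occur,
  since otherwise the permutation is the identity, which would force w to be d copies of the letter
  d; exponents smaller than their letter exclude this. Coxeter length equals the number of
  inversions (\<open>coxeter_length_eq_card_inversions\<close>), and a Grassmannian permutation p has
  \<open>\<Sum>x\<le>d. p x - x\<close> of them (\<open>card_inversions_grassmannian\<close>), here the sum of the letters
  minus d squared. Left multiplication by s_r adds or removes one inversion according to whether r
  is an ascent or a descent, which gives the lengths of s_r p. The hypotheses on w pass to
  every segment of w, so segments are elementary and obey the same length formula; strict
  subadditivity is then that the square of a sum of two positive numbers exceeds the sum of
  their squares.

  For the factorization, t_k to the power k is the identity, so the powers of t_k can be regrouped
  and the product telescopes (\<open>ogs_prod_telescope\<close>). For the normal form, t_k to the power d is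
  spelled by the staircase with d letters in each of the rows d, ..., k - 1
  (\<open>word_perm_staircase_const\<close>). Cutting that staircase at row a shows that its rows
  a, ..., k - 1 spell t_a^(a-d) t_k^d, which is a factor of the telescoped product. So the claimed
  word spells the right permutation; it is reduced because its number of letters is the Coxeter
  length, and staircase words are determined by their permutation (\<open>staircase_word_unique\<close>).
\<close>

section \<open>Products from left to right\<close>

lemma lr_mult_assoc: "(p \<odot> q) \<odot> r = p \<odot> (q \<odot> r)"
  by (simp add: lr_mult_def)

lemma lr_mult_id [simp]: "id \<odot> p = p" "p \<odot> id = p" "(\<lambda>x. x) \<odot> p = p" "p \<odot> (\<lambda>x. x) = p"
  by (simp_all add: lr_mult_def)

lemma lr_prod_simps [simp]: "lr_prod [] = id" "lr_prod (p # ps) = p \<odot> lr_prod ps"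
  by (simp_all add: lr_prod_def)

lemma lr_prod_append [simp]: "lr_prod (ps @ qs) = lr_prod ps \<odot> lr_prod qs"
  by (induction ps) (simp_all add: lr_mult_assoc)

lemma lr_prod_replicate: "lr_prod (replicate a p) = p ^^ a"
  by (induction a) (simp_all add: lr_mult_def fun_eq_iff funpow_swap1[symmetric])

lemma funpow_lr_mult: "(p ^^ a) \<odot> (p ^^ b) = p ^^ (a + b)"
  using funpow_add[of b a p] by (simp add: lr_mult_def comp_def add.commute)

lemma permutes_lr_mult: "p permutes S \<Longrightarrow> q permutes S \<Longrightarrow> p \<odot> q permutes S"
  using permutes_compose[of p S q] by (simp add: lr_mult_def comp_def)

lemma word_perm_simps [simp]:
  "word_perm [] = id" "word_perm (r # w) = adj r \<odot> word_perm w"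
  "word_perm (v @ w) = word_perm v \<odot> word_perm w"
  by (simp_all add: word_perm_def)

lemma word_perm_concat: "word_perm (concat ws) = lr_prod (map word_perm ws)"
  by (induction ws) simp_all

lemma adj_apply: "adj r x = (if x = r then r + 1 else if x = r + 1 then r else x)"
  by (simp add: adj_def transpose_def)

lemma adj_adj [simp]: "adj r (adj r x) = x"
  by (simp add: adj_def)

lemma adj_permutes: "1 \<le> r \<Longrightarrow> r < n \<Longrightarrow> adj r permutes {1..n}"
  unfolding adj_def by (rule permutes_swap_id) auto

lemma word_perm_permutes: "set w \<subseteq> {1..<n} \<Longrightarrow> word_perm w permutes {1..n}"
proof (induction w)
  case (Cons r w)
  then show ?case using permutes_lr_mult[OF adj_permutes[of r n]] by simp
qed (simp add: permutes_id)

section \<open>Coxeter length and inversions\<close>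

definition inversions :: "nat \<Rightarrow> (nat \<Rightarrow> nat) \<Rightarrow> (nat \<times> nat) set"
  where "inversions n p = {(a, b). 1 \<le> a \<and> a < b \<and> b \<le> n \<and> p b < p a}"

lemma finite_inversions [simp]: "finite (inversions n p)"
  by (rule finite_subset[of _ "{1..n} \<times> {1..n}"]) (auto simp: inversions_def)

lemma inversions_id [simp]: "inversions n id = {}" "inversions n (\<lambda>x. x) = {}"
  by (auto simp: inversions_def)

text \<open>
  Applying s_r to both entries of an increasing pair preserves their order unless the pair is
  (r, r+1). It therefore matches the inversions of p with those inversions of s_r p that differ from (r, r+1),
  and the latter pair is new.
\<close>
lemma card_inversions_ascent:
  assumes r: "1 \<le> r" "r < n" and asc: "p r < p (r + 1)"
  shows "card (inversions n (adj r \<odot> p)) = card (inversions n p) + 1"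
proof -
  let ?s = "map_prod (adj r) (adj r)"
  have ord: "adj r a < adj r b" if "a < b" "(a, b) \<noteq> (r, r + 1)" for a b
    using that by (auto simp: adj_apply)
  have rng: "1 \<le> adj r a \<longleftrightarrow> 1 \<le> a" "adj r a \<le> n \<longleftrightarrow> a \<le> n" for a
    using r by (auto simp: adj_apply)
  have inv: "?s (?s z) = z" for z
    by (cases z) simp
  have "inversions n (adj r \<odot> p) = insert (r, r + 1) (?s ` inversions n p)"
  proof (intro set_eqI iffI)
    fix z assume z: "z \<in> inversions n (adj r \<odot> p)"
    show "z \<in> insert (r, r + 1) (?s ` inversions n p)"
    proof (cases "z = (r, r + 1)")
      case False
      obtain a b where ab: "z = (a, b)" by (cases z)
      have "?s z \<in> inversions n p"
        using z False ord[of a b] rng[of a] rng[of b] by (auto simp: ab inversions_def lr_mult_def)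
      then have "?s (?s z) \<in> ?s ` inversions n p" by (rule imageI)
      then show ?thesis by (simp add: inv)
    qed simp
  next
    fix z assume "z \<in> insert (r, r + 1) (?s ` inversions n p)"
    then show "z \<in> inversions n (adj r \<odot> p)"
    proof
      assume "z = (r, r + 1)"
      then show ?thesis using r asc by (auto simp: inversions_def lr_mult_def adj_apply)
    next
      assume "z \<in> ?s ` inversions n p"
      then obtain a b where ab: "(a, b) \<in> inversions n p" "z = (adj r a, adj r b)" by auto
      have "(a, b) \<noteq> (r, r + 1)" using ab(1) asc by (auto simp: inversions_def)
      then show ?thesis
        using ab ord[of a b] rng[of a] rng[of b] by (auto simp: inversions_def lr_mult_def)
    qed
  qed
  moreover have "(r, r + 1) \<notin> ?s ` inversions n p"
  proof
    assume "(r, r + 1) \<in> ?s ` inversions n p"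
    then obtain a b where ab: "(a, b) \<in> inversions n p" "adj r a = r" "adj r b = r + 1" by auto
    then have "a = adj r r" "b = adj r (r + 1)" by (metis adj_adj)+
    then show False using ab(1) by (simp add: adj_apply inversions_def)
  qed
  moreover have "inj_on ?s (inversions n p)"
    by (rule inj_on_inverseI[of _ ?s]) (simp add: inv)
  ultimately show ?thesis
    by (simp add: card_image)
qed

lemma card_inversions_descent:
  assumes r: "1 \<le> r" "r < n" and desc: "p (r + 1) < p r"
  shows "card (inversions n p) = card (inversions n (adj r \<odot> p)) + 1"
proof -
  have "adj r \<odot> (adj r \<odot> p) = p" by (simp add: lr_mult_def)
  moreover have "(adj r \<odot> p) r < (adj r \<odot> p) (r + 1)"
    using desc by (simp add: lr_mult_def adj_apply)
  ultimately show ?thesis using card_inversions_ascent[OF r, of "adj r \<odot> p"] by simp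
qed

text \<open>
  Without descents p is strictly increasing on {1..n}, so no value lies below its
  position; the only such permutation is the identity.
\<close>
lemma descents_empty_imp_id:
  assumes p: "p permutes {1..n}" and no_desc: "descents n p = {}"
  shows "p = id"
proof -
  have inj: "inj p" using p by (rule permutes_inj)
  have step: "p i < p (i + 1)" if "1 \<le> i" "i < n" for i
  proof -
    have "\<not> p (i + 1) < p i" using no_desc that unfolding descents_def by blast
    moreover have "p i \<noteq> p (i + 1)" using inj_eq[OF inj, of i "i + 1"] by simp
    ultimately show ?thesis by linarith
  qed
  have ge: "x \<le> n \<Longrightarrow> x \<le> p x" for x
  proof (induction x)
    case (Suc x)
    show ?case
    proof (cases "x = 0")
      case True
      have "p 1 \<in> {1..n}" using Suc.prems True permutes_in_image[OF p, of 1] by auto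
      then show ?thesis using True by simp
    next
      case False
      then show ?thesis using Suc step[of x] by simp
    qed
  qed simp
  show ?thesis by (rule permutes_natset_ge[OF p]) (use ge in auto)
qed

lemma card_inversions_le_length:
  "set w \<subseteq> {1..<n} \<Longrightarrow> card (inversions n (word_perm w)) \<le> length w"
proof (induction w)
  case Nil
  then show ?case by simp
next
  case (Cons r w)
  let ?p = "word_perm w"
  have r: "1 \<le> r" "r < n" using Cons.prems by auto
  have "?p r \<noteq> ?p (r + 1)"
    using inj_eq[OF permutes_inj[OF word_perm_permutes[of w n]], of r "r + 1"] Cons.prems by auto
  then consider "?p r < ?p (r + 1)" | "?p (r + 1) < ?p r" by linarith
  then show ?case
    using card_inversions_ascent[OF r, of ?p] card_inversions_descent[OF r, of ?p] Cons
    by cases auto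
qed

text \<open>
  Sorting by adjacent transpositions: as long as a descent r exists, multiplying by s_r on the left
  removes one inversion.
\<close>
lemma word_of_length_card_inversions:
  assumes "p permutes {1..n}"
  shows "\<exists>w. set w \<subseteq> {1..<n} \<and> word_perm w = p \<and> length w = card (inversions n p)"
  using assms
proof (induction "card (inversions n p)" arbitrary: p rule: less_induct)
  case less
  show ?case
  proof (cases "descents n p = {}")
    case True
    then have "p = id" using less.prems by (rule descents_empty_imp_id[rotated])
    then show ?thesis by (intro exI[of _ "[]"]) simp
  next
    case False
    then obtain r where r: "1 \<le> r" "r < n" "p (r + 1) < p r" by (auto simp: descents_def)
    note desc = card_inversions_descent[OF r]
    have "adj r \<odot> p permutes {1..n}"
      by (rule permutes_lr_mult[OF adj_permutes[OF r(1,2)] less.prems])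
    then obtain w where w: "set w \<subseteq> {1..<n}" "word_perm w = adj r \<odot> p"
        "length w = card (inversions n (adj r \<odot> p))"
      using less.hyps[of "adj r \<odot> p"] desc by auto
    have "word_perm (r # w) = p" by (simp add: w lr_mult_def)
    then show ?thesis using w r desc by (intro exI[of _ "r # w"]) simp
  qed
qed

lemma coxeter_length_eq_card_inversions:
  assumes "p permutes {1..n}"
  shows "coxeter_length n p = card (inversions n p)"
  unfolding coxeter_length_def
  by (rule Least_equality)
    (use word_of_length_card_inversions[OF assms] card_inversions_le_length in blast)+

lemma coxeter_length_adj:
  assumes p: "p permutes {1..n}" and r: "1 \<le> r" "r < n"
  shows "int (coxeter_length n (adj r \<odot> p)) =
    (if r \<in> descents n p then int (coxeter_length n p) - 1 else int (coxeter_length n p) + 1)"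
proof -
  have "p r \<noteq> p (r + 1)" using inj_eq[OF permutes_inj[OF p], of r "r + 1"] by simp
  moreover have "coxeter_length n p = card (inversions n p)"
    "coxeter_length n (adj r \<odot> p) = card (inversions n (adj r \<odot> p))"
    by (intro coxeter_length_eq_card_inversions permutes_lr_mult adj_permutes p r)+
  ultimately show ?thesis
    using card_inversions_ascent[OF r, of p] card_inversions_descent[OF r, of p] r
    by (auto simp: descents_def not_less le_less)
qed

text \<open>
  An inversion must have its first entry x at most d and its second beyond d. The p x - 1 values
  below p x are taken at the x - 1 positions before x and at the positions beyond d that form an
  inversion with x, so there are p x - x of the latter.
\<close>
lemma card_inversions_grassmannian:
  assumes p: "p permutes {1..n}" and d: "d \<le> n"
    and low: "strict_mono_on {1..d} p" and high: "strict_mono_on {d<..n} p"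
  shows "int (card (inversions n p)) = (\<Sum>x=1..d. int (p x) - int x)"
proof -
  define B where "B x = {y \<in> {d<..n}. p y < p x}" for x
  have "inversions n p = Sigma {1..d} B"
  proof (intro set_eqI iffI)
    fix z assume "z \<in> inversions n p"
    then obtain a b where ab: "z = (a, b)" "1 \<le> a" "a < b" "b \<le> n" "p b < p a"
      by (auto simp: inversions_def)
    have "\<not> b \<le> d" using strict_mono_onD[OF low, of a b] ab by auto
    moreover have "\<not> d < a" using strict_mono_onD[OF high, of a b] ab by auto
    ultimately show "z \<in> Sigma {1..d} B" using ab by (auto simp: B_def)
  qed (auto simp: inversions_def B_def)
  then have "card (inversions n p) = (\<Sum>x=1..d. card (B x))"
    by (simp add: card_SigmaI B_def)
  moreover have "int (card (B x)) = int (p x) - int x" if x: "x \<in> {1..d}" for x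
  proof -
    (* The positions with value below p x are the earlier ones and those paired with x. *)
    have "p ` ({1..<x} \<union> B x) = {1..<p x}"
    proof (intro equalityI subsetI)
      fix v assume "v \<in> p ` ({1..<x} \<union> B x)"
      then obtain y where y: "v = p y" "y \<in> {1..<x} \<union> B x" by (rule imageE)
      then have "y \<in> {1..n}" using x d by (auto simp: B_def)
      then have "1 \<le> p y" using permutes_in_image[OF p, of y] by auto
      moreover have "p y < p x" using y x strict_mono_onD[OF low, of y x] by (auto simp: B_def)
      ultimately show "v \<in> {1..<p x}" using y by simp
    next
      fix v assume v: "v \<in> {1..<p x}"
      have "p x \<in> {1..n}" using permutes_in_image[OF p, of x] x d by auto
      then have "v \<in> p ` {1..n}" using v permutes_image[OF p] by auto
      then obtain y where y: "y \<in> {1..n}" "v = p y" by auto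
      have "y < x" if "y \<le> d"
      proof (rule ccontr)
        assume "\<not> y < x"
        then have "p x \<le> p y"
          using strict_mono_onD[OF low, of x y] x y that by (cases "x = y") auto
        then show False using v y by simp
      qed
      then show "v \<in> p ` ({1..<x} \<union> B x)" using y v by (force simp: B_def)
    qed
    then have "card ({1..<x} \<union> B x) = p x - 1"
      using card_image[OF inj_on_subset[OF permutes_inj[OF p] subset_UNIV],
        of "{1..<x} \<union> B x"] by simp
    moreover have "card ({1..<x} \<union> B x) = (x - 1) + card (B x)"
      using x by (subst card_Un_disjoint) (auto simp: B_def)
    moreover have "1 \<le> p x" using permutes_in_image[OF p, of x] x d by auto
    ultimately show ?thesis using x by auto
  qed
  ultimately show ?thesis by simp
qed

section \<open>The generators $t_k$ and their powers\<close>

lemma ogs_gen_apply: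
  assumes "1 \<le> k"
  shows "ogs_gen k x = (if x = 1 then k else if 1 < x \<and> x \<le> k then x - 1 else x)"
  using assms
proof (induction k rule: dec_induct)
  case base
  then show ?case by (simp add: ogs_gen_def)
next
  case (step k)
  have "ogs_gen (Suc k) = ogs_gen k \<odot> adj k"
    using step by (simp add: ogs_gen_def)
  then show ?case using step by (auto simp: lr_mult_def adj_apply)
qed

lemma ogs_gen_permutes: "k \<le> n \<Longrightarrow> ogs_gen k permutes {1..n}"
  unfolding ogs_gen_def by (rule word_perm_permutes) auto

lemma ogs_gen_pow_apply:
  assumes "1 \<le> k" "d \<le> k"
  shows "(ogs_gen k ^^ d) x =
    (if 1 \<le> x \<and> x \<le> d then x + k - d else if d < x \<and> x \<le> k then x - d else x)"
  using assms(2)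
proof (induction d)
  case (Suc d)
  then show ?case using assms(1) by (auto simp: ogs_gen_apply)
qed auto

lemma ogs_gen_pow_self: "1 \<le> k \<Longrightarrow> ogs_gen k ^^ k = id"
  by (auto simp: fun_eq_iff ogs_gen_pow_apply)

section \<open>Staircase words\<close>

lemma staircase_append:
  "a \<le> b \<Longrightarrow> b \<le> c \<Longrightarrow> staircase a c y = staircase a b y @ staircase b c y"
  using upt_add_eq_append[of a b "c - b"] by (simp add: staircase_def)

lemma staircase_cong: "(\<And>u. a \<le> u \<Longrightarrow> u < b \<Longrightarrow> y u = z u) \<Longrightarrow> staircase a b y = staircase a b z"
  unfolding staircase_def by (rule arg_cong[of _ _ concat]) auto

lemma staircase_zero: "staircase a b (\<lambda>_. 0) = []"
  by (simp add: staircase_def)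

lemma staircase_Suc:
  "a \<le> b \<Longrightarrow> staircase a (Suc b) y = staircase a b y @ map (\<lambda>r. b - r) [0..<y b]"
  by (simp add: staircase_def)

lemma length_staircase_const: "length (staircase a b (\<lambda>_. d)) = (b - a) * d"
  by (simp add: staircase_def length_concat comp_def sum_list_triv)

lemma set_staircase:
  assumes "\<forall>u\<in>{a..<b}. y u \<le> u" "1 \<le> a"
  shows "set (staircase a b y) \<subseteq> {1..<b}"
  using assms by (fastforce simp: staircase_def)

lemma word_perm_row:
  assumes "d \<le> u"
  shows "word_perm (map (\<lambda>r. u - r) [0..<d]) x =
    (if x = u + 1 then u + 1 - d else if u - d < x \<and> x \<le> u then x + 1 else x)"
  using assms
proof (induction d)
  case (Suc d)
  have "word_perm (map (\<lambda>r. u - r) [0..<Suc d]) x =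
      adj (u - d) (word_perm (map (\<lambda>r. u - r) [0..<d]) x)"
    by (simp add: lr_mult_def)
  also have "\<dots> = adj (u - d) (if x = u + 1 then u + 1 - d else if u - d < x \<and> x \<le> u then x + 1 else x)"
    using Suc by simp
  also have "\<dots> = (if x = u + 1 then u + 1 - Suc d else if u - Suc d < x \<and> x \<le> u then x + 1 else x)"
    unfolding adj_apply using Suc.prems by (simp split: if_split) linarith
  finally show ?case .
qed simp

text \<open>
  Row u carries the value u + 1 down to u + 1 - d and raises the d values just below u + 1 by one. A
  position x above d is untouched until row x - 1, which drops it by d to where later rows do not
  reach; a position up to d is raised by every one of the k - d rows. This is the d-th power of the
  cyclic shift t_k.
\<close>
lemma word_perm_staircase_const:
  assumes "d \<le> k" "1 \<le> k"
  shows "word_perm (staircase d k (\<lambda>_. d)) = ogs_gen k ^^ d"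
proof -
  have "word_perm (staircase d k (\<lambda>_. d)) x =
    (if 1 \<le> x \<and> x \<le> d then x + k - d else if d < x \<and> x \<le> k then x - d else x)" for x
    using assms(1)
  proof (induction k rule: dec_induct)
    case base
    then show ?case by (simp add: staircase_def)
  next
    case (step k)
    then show ?case by (auto simp: staircase_Suc lr_mult_def word_perm_row)
  qed
  then show ?thesis using assms by (simp add: fun_eq_iff ogs_gen_pow_apply)
qed

text \<open>
  The rows d, ..., a - 1 spell t_a^d and the rows d, ..., b - 1 spell t_b^d, so the
  rows in between spell the quotient of the two.
\<close>
lemma word_perm_staircase_segment:
  assumes "d \<le> a" "a \<le> b" "1 \<le> a"
  shows "word_perm (staircase a b (\<lambda>_. d)) = (ogs_gen a ^^ (a - d)) \<odot> (ogs_gen b ^^ d)"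
proof -
  have "ogs_gen b ^^ d = (ogs_gen a ^^ d) \<odot> word_perm (staircase a b (\<lambda>_. d))"
    using word_perm_staircase_const[of d a] word_perm_staircase_const[of d b]
      staircase_append[of d a b "\<lambda>_. d"] assms by simp
  then have "(ogs_gen a ^^ (a - d)) \<odot> (ogs_gen b ^^ d) =
      (ogs_gen a ^^ a) \<odot> word_perm (staircase a b (\<lambda>_. d))"
    using assms by (simp flip: lr_mult_assoc add: funpow_lr_mult)
  then show ?thesis using assms by (simp add: ogs_gen_pow_self)
qed

text \<open>
  The last row alone moves the top point n, lowering it by its number of letters. The permutation
  thus determines the length of the last row, and cancelling that row leaves a shorter staircase.
\<close>
lemma staircase_word_unique:
  assumes "\<forall>u\<in>{1..<n}. y u \<le> u" "\<forall>u\<in>{1..<n}. z u \<le> u"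
    and "word_perm (staircase 1 n y) = word_perm (staircase 1 n z)"
  shows "staircase 1 n y = staircase 1 n z"
  using assms
proof (induction n)
  case 0
  then show ?case by (simp add: staircase_def)
next
  case (Suc n)
  show ?case
  proof (cases "n = 0")
    case True
    then show ?thesis by (simp add: staircase_def)
  next
    case False
    let ?row = "\<lambda>y. map (\<lambda>r. n - r) [0..<y n]"
    have top: "word_perm (staircase 1 (Suc n) y) (n + 1) = n + 1 - y n"
      if "\<forall>u\<in>{1..<Suc n}. y u \<le> u" for y
    proof -
      have "word_perm (staircase 1 n y) permutes {1..n}"
        by (rule word_perm_permutes) (use that in \<open>intro set_staircase; auto\<close>)
      then have "word_perm (staircase 1 n y) (n + 1) = n + 1"
        by (rule permutes_not_in) simp
      then show ?thesis
        using False that by (simp add: staircase_Suc lr_mult_def word_perm_row)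
    qed
    have row: "y n = z n"
    proof -
      have "n + 1 - y n = n + 1 - z n"
        using top[OF Suc.prems(1)] top[OF Suc.prems(2)] Suc.prems(3) by simp
      moreover have "y n \<le> n" "z n \<le> n" using Suc.prems False by auto
      ultimately show ?thesis by linarith
    qed
    have "z n \<le> n" using Suc.prems False by auto
    then have "word_perm (?row z) permutes {1..Suc n}"
      by (intro word_perm_permutes) auto
    then have "inj (word_perm (?row z))" by (rule permutes_inj)
    moreover have "word_perm (staircase 1 n y) \<odot> word_perm (?row z) =
        word_perm (staircase 1 n z) \<odot> word_perm (?row z)"
      using Suc.prems(3) False row by (simp add: staircase_Suc)
    ultimately have "word_perm (staircase 1 n y) = word_perm (staircase 1 n z)"
      by (auto simp: lr_mult_def fun_eq_iff inj_eq)
    then have "staircase 1 n y = staircase 1 n z" using Suc.IH Suc.prems by auto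
    then show ?thesis using False row by (simp add: staircase_Suc)
  qed
qed

lemma normal_form_eqI:
  assumes "reduced_word n p (staircase 1 n y)" "\<forall>u\<in>{1..<n}. y u \<le> u"
  shows "normal_form n p = staircase 1 n y"
  unfolding normal_form_def
proof (rule the_equality)
  fix w assume w: "reduced_word n p w \<and> (\<exists>z. (\<forall>u\<in>{1..<n}. z u \<le> u) \<and> w = staircase 1 n z)"
  then obtain z where z: "\<forall>u\<in>{1..<n}. z u \<le> u" "w = staircase 1 n z" by blast
  show "w = staircase 1 n y"
    unfolding z(2) by (rule staircase_word_unique) (use assms w z in \<open>auto simp: reduced_word_def\<close>)
qed (use assms in blast)

section \<open>Elementary words\<close>

lemma count_list_replicate: "count_list (replicate d a) b = (if a = b then d else 0)"
  by (induction d) auto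

text \<open>
  Words of elementary elements: \<open>ogs_word\<close> of an elementary form satisfies this, and every nonempty
  word with these properties comes from such a form. All
  conditions survive shortening the word, so they pass to segments.
\<close>
definition elementary_word :: "nat \<Rightarrow> nat list \<Rightarrow> bool"
  where "elementary_word n w \<longleftrightarrow> sorted w \<and>
    (\<forall>a\<in>set w. 2 \<le> a \<and> a \<le> n \<and> count_list w a < a \<and> length w \<le> a)"

lemma ogs_word_perm_simps [simp]:
  "ogs_word_perm [] = id" "ogs_word_perm (a # w) = ogs_gen a \<odot> ogs_word_perm w"
  "ogs_word_perm (v @ w) = ogs_word_perm v \<odot> ogs_word_perm w"
  by (simp_all add: ogs_word_perm_def)

lemma ogs_word_perm_permutes: "\<forall>a\<in>set w. a \<le> n \<Longrightarrow> ogs_word_perm w permutes {1..n}"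
  by (induction w) (simp_all add: permutes_id permutes_lr_mult ogs_gen_permutes del: One_nat_def)

text \<open>
  Each letter lowers the current value by one, because that value is still at least 2 when the letter
  acts and never exceeds a letter.
\<close>
lemma ogs_word_perm_shift:
  "length w < x \<Longrightarrow> \<forall>a\<in>set w. x \<le> a \<Longrightarrow> ogs_word_perm w x = x - length w"
proof (induction w arbitrary: x)
  case (Cons a w)
  have "\<forall>b\<in>set w. x - 1 \<le> b" using Cons.prems(2) by fastforce
  then have "ogs_word_perm w (x - 1) = x - 1 - length w"
    using Cons.prems(1) by (intro Cons.IH) auto
  moreover have "ogs_gen a x = x - 1" using Cons.prems by (simp add: ogs_gen_apply)
  ultimately show ?case by (simp add: lr_mult_def)
qed simp

text \<open>
  Induction on the word: the first letter a lifts 1 to a, from where the remaining letters lower it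
  by one each; every other position is lowered by one and becomes a position for the remaining word.
\<close>
lemma ogs_word_perm_low:
  assumes "sorted w" "\<forall>a\<in>set w. length w \<le> a" "x < length w"
  shows "ogs_word_perm w (Suc x) + length w = Suc x + w ! x"
  using assms
proof (induction w arbitrary: x)
  case (Cons a w)
  have a: "1 \<le> a" "length w < a" using Cons.prems by auto
  show ?case
  proof (cases x)
    case 0
    then show ?thesis
      using ogs_word_perm_shift[of w a] Cons.prems a by (simp add: lr_mult_def ogs_gen_apply)
  next
    case (Suc z)
    then have "ogs_gen a (Suc x) = Suc z" using Cons.prems by (auto simp: ogs_gen_apply)
    moreover have "ogs_word_perm w (Suc z) + length w = Suc z + w ! z"
      using Cons.prems Suc by (intro Cons.IH) auto
    ultimately show ?thesis using Suc by (simp add: lr_mult_def)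
  qed
qed simp

text \<open>
  A letter is strictly increasing on positions above 1 and lowers them by at most one. A position
  that exceeds the number of letters still to come is therefore above 1 whenever a letter acts.
\<close>
lemma ogs_word_perm_high:
  assumes "\<forall>a\<in>set w. length w \<le> a" "length w < x" "x < y"
  shows "ogs_word_perm w x < ogs_word_perm w y"
  using assms
proof (induction w arbitrary: x y)
  case (Cons a w)
  have "length w < ogs_gen a x" "ogs_gen a x < ogs_gen a y"
    using Cons.prems by (auto simp: ogs_gen_apply)
  moreover have "\<forall>b\<in>set w. length w \<le> b" using Cons.prems(1) by fastforce
  ultimately show ?case unfolding ogs_word_perm_simps lr_mult_def by (intro Cons.IH)
qed simp

lemma ogs_word_perm_low_strict_mono:
  assumes "sorted w" "\<forall>a\<in>set w. length w \<le> a"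
  shows "strict_mono_on {1..length w} (ogs_word_perm w)"
proof (rule strict_mono_onI)
  fix x y assume xy: "x \<in> {1..length w}" "y \<in> {1..length w}" "x < y"
  then obtain a b where ab: "x = Suc a" "y = Suc b" "a < b" "b < length w"
    by (cases x; cases y) auto
  then show "ogs_word_perm w x < ogs_word_perm w y"
    using ogs_word_perm_low[OF assms, of a] ogs_word_perm_low[OF assms, of b]
      sorted_nth_mono[OF assms(1), of a b] by simp
qed

lemma elementary_word_permutes: "elementary_word n w \<Longrightarrow> ogs_word_perm w permutes {1..n}"
  by (rule ogs_word_perm_permutes) (simp add: elementary_word_def)

lemma elementary_word_length_le: "elementary_word n w \<Longrightarrow> length w \<le> n"
  by (cases w) (auto simp: elementary_word_def)

lemma coxeter_length_elementary_word:
  assumes "elementary_word n w"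
  shows "int (coxeter_length n (ogs_word_perm w)) = int (sum_list w) - (int (length w))\<^sup>2"
proof -
  let ?p = "ogs_word_perm w" and ?d = "length w"
  have w: "sorted w" "\<forall>a\<in>set w. ?d \<le> a" using assms by (auto simp: elementary_word_def)
  have "int (coxeter_length n ?p) = (\<Sum>x=1..?d. int (?p x) - int x)"
    unfolding coxeter_length_eq_card_inversions[OF elementary_word_permutes[OF assms]]
    using elementary_word_permutes[OF assms] elementary_word_length_le[OF assms]
      ogs_word_perm_low_strict_mono[OF w] ogs_word_perm_high[OF w(2)]
    by (intro card_inversions_grassmannian) (auto simp: strict_mono_on_def)
  also have "\<dots> = (\<Sum>x<?d. int (?p (Suc x)) - int (Suc x))"
    by (simp add: sum.atLeast1_atMost_eq)
  also have "\<dots> = (\<Sum>x<?d. int (w ! x) - int ?d)"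
  proof (rule sum.cong)
    fix x assume "x \<in> {..<?d}"
    then have "int (?p (Suc x) + ?d) = int (Suc x + w ! x)"
      using ogs_word_perm_low[OF w, of x] by simp
    then show "int (?p (Suc x)) - int (Suc x) = int (w ! x) - int ?d" by simp
  qed simp
  also have "\<dots> = int (sum_list w) - (int ?d)\<^sup>2"
    by (simp add: sum_subtractf sum_list_sum_nth atLeast0LessThan power2_eq_square)
  finally show ?thesis .
qed

text \<open>
  The permutation increases up to the length d of the word and beyond it, so d is the only candidate.
  If there were no descent at all, the permutation would be the identity. Then d is fixed, which
  makes the last, hence largest, letter equal to d; all letters are at least d, so all d of them equal
  d, whereas a letter occurs fewer times than its value.
\<close>
lemma descents_elementary_word:
  assumes "elementary_word n w" "w \<noteq> []"
  shows "descents n (ogs_word_perm w) = {length w}"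
proof -
  let ?p = "ogs_word_perm w" and ?d = "length w"
  have w: "sorted w" "\<forall>a\<in>set w. ?d \<le> a" using assms by (auto simp: elementary_word_def)
  have "descents n ?p \<subseteq> {?d}"
  proof
    fix r assume "r \<in> descents n ?p"
    then have r: "1 \<le> r" "?p (r + 1) < ?p r" by (auto simp: descents_def)
    have "\<not> r < ?d"
      using strict_mono_onD[OF ogs_word_perm_low_strict_mono[OF w], of r "r + 1"] r by auto
    moreover have "\<not> ?d < r" using ogs_word_perm_high[OF w(2), of r "r + 1"] r by auto
    ultimately show "r \<in> {?d}" by simp
  qed
  moreover have "descents n ?p \<noteq> {}"
  proof
    assume "descents n ?p = {}"
    then have "?p = id"
      by (rule descents_empty_imp_id[OF elementary_word_permutes[OF assms(1)]])
    (* Position d is sent to the last letter, by the formula for the positions up to d. *)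
    then have last: "w ! (?d - 1) = ?d"
      using ogs_word_perm_low[OF w, of "?d - 1"] assms(2) by simp
    have "a = ?d" if a: "a \<in> set w" for a
    proof -
      obtain x where "x < ?d" "a = w ! x" using a by (auto simp: in_set_conv_nth)
      then have "a \<le> ?d"
        using sorted_nth_mono[OF w(1), of x "?d - 1"] last by linarith
      then show ?thesis using w(2) a by (simp add: le_antisym)
    qed
    then have eq: "w = replicate ?d ?d"
      by (intro replicate_eqI) auto
    have "count_list w ?d = ?d" by (subst eq) (simp add: count_list_replicate)
    moreover have "?d \<in> set w" using last assms(2) nth_mem[of "?d - 1" w] by simp
    ultimately show False using assms(1) by (auto simp: elementary_word_def)
  qed
  ultimately show ?thesis by blast
qed

lemma elementary_word_sublist:
  assumes "elementary_word n w" "sublist v w"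
  shows "elementary_word n v"
proof -
  obtain ps ss where "w = ps @ v @ ss" using assms(2) by (auto simp: sublist_def)
  then have "sorted w \<Longrightarrow> sorted v" "set v \<subseteq> set w" "length v \<le> length w"
    "count_list v a \<le> count_list w a" for a
    by (auto simp: sorted_append)
  then show ?thesis using assms(1) unfolding elementary_word_def
    by (meson le_less_trans order_trans subsetD)
qed

text \<open>
  Keeping the list of letters separate from the exponents lets this form cover both \<open>ogs_word\<close>,
  whose letters are k 1, ..., k m, and an arbitrary sorted word, whose letters are read
  off its set of elements.
\<close>
definition block_word :: "(nat \<Rightarrow> nat) \<Rightarrow> nat list \<Rightarrow> nat list"
  where "block_word f ks = concat (map (\<lambda>a. replicate (f a) a) ks)"

lemma block_word_simps [simp]:
  "block_word f [] = []" "block_word f (a # ks) = replicate (f a) a @ block_word f ks"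
  by (simp_all add: block_word_def)

lemma set_block_word: "set (block_word f ks) = {a \<in> set ks. 0 < f a}"
  by (auto simp: block_word_def split: if_splits)

lemma sorted_block_word: "sorted ks \<Longrightarrow> sorted (block_word f ks)"
  by (induction ks) (auto simp: sorted_append set_block_word)

lemma length_block_word: "length (block_word f ks) = sum_list (map f ks)"
  by (induction ks) auto

lemma sum_list_block_word: "sum_list (block_word f ks) = (\<Sum>a\<leftarrow>ks. a * f a)"
  by (induction ks) (auto simp: sum_list_replicate)

lemma count_block_word:
  "distinct ks \<Longrightarrow> count_list (block_word f ks) a = (if a \<in> set ks then f a else 0)"
  by (induction ks) (auto simp: count_list_replicate)

lemma ogs_word_perm_block_word:
  "ogs_word_perm (block_word f ks) = lr_prod (map (\<lambda>a. ogs_gen a ^^ f a) ks)"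
  by (induction ks) (simp_all add: ogs_word_perm_def lr_prod_replicate)

lemma sorted_eq_block_word:
  assumes "sorted w"
  shows "w = block_word (count_list w) (sorted_list_of_set (set w))"
proof -
  have "mset (block_word (count_list w) (sorted_list_of_set (set w))) = mset w"
    by (rule multiset_eqI) (auto simp: count_mset count_block_word)
  then have "sort w = block_word (count_list w) (sorted_list_of_set (set w))"
    by (rule properties_for_sort) (simp add: sorted_block_word)
  then show ?thesis using assms by (simp add: sorted_sort_id)
qed

lemma ogs_word_eq_block_word: "ogs_word m k i = block_word i (map k [1..<m+1])"
  by (simp add: ogs_word_def block_word_def comp_def)

text \<open>
  The canonical form is recovered from the word: its letters are the distinct entries
  in increasing order, its exponents are their multiplicities.
\<close>
lemma ogs_elementary_elementary_word:
  assumes "elementary_word n w" "w \<noteq> []"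
  shows "ogs_elementary n (ogs_word_perm w)"
proof -
  define ks where "ks = sorted_list_of_set (set w)"
  define k where "k j = ks ! (j - 1)" for j
  define m where "m = length ks"
  have ks: "sorted ks" "distinct ks" "set ks = set w" by (simp_all add: ks_def)
  have m: "1 \<le> m" using ks(3) assms(2) by (cases ks) (auto simp: m_def)
  have word: "w = block_word (count_list w) ks"
    unfolding ks_def using assms(1) by (intro sorted_eq_block_word) (simp add: elementary_word_def)
  have map_k: "map k [1..<m+1] = ks"
    by (rule nth_equalityI) (auto simp: k_def m_def simp del: upt_Suc)
  have kin: "k j \<in> set w" if "j \<in> {1..m}" for j
  proof -
    have "j - 1 < length ks" using that by (simp add: m_def) linarith
    then show ?thesis unfolding k_def ks(3)[symmetric] by (rule nth_mem)
  qed
  have "strict_mono_on {1..m} k"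
  proof (rule strict_mono_onI)
    fix x y assume "x \<in> {1..m}" "y \<in> {1..m}" "x < y"
    then have "x - 1 < y - 1" "y - 1 < length ks" by (auto simp: m_def)
    moreover have "sorted_wrt (<) ks" using ks by (simp add: strict_sorted_iff)
    ultimately show "k x < k y" unfolding k_def by (intro sorted_wrt_nth_less[of "(<)"])
  qed
  moreover have "0 < count_list w a" if "a \<in> set w" for a
    using that by (simp add: count_list_0_iff flip: neq0_conv)
  moreover have "(\<Sum>j=1..m. count_list w (k j)) = length w"
  proof -
    have "length w = sum_list (map (count_list w) ks)"
      by (subst word) (rule length_block_word)
    also have "\<dots> = (\<Sum>j\<leftarrow>[1..<m+1]. count_list w (k j))"
      by (simp flip: map_k add: comp_def del: upt_Suc)
    also have "\<dots> = (\<Sum>j=1..m. count_list w (k j))"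
      by (simp add: sum_list_distinct_conv_sum_set atLeastLessThanSuc_atLeastAtMost del: upt_Suc)
    finally show ?thesis by simp
  qed
  moreover have "ogs_word_perm w = lr_prod (map (\<lambda>j. ogs_gen (k j) ^^ count_list w (k j)) [1..<m+1])"
  proof -
    have "ogs_word_perm w = lr_prod (map (\<lambda>a. ogs_gen a ^^ count_list w a) ks)"
      by (subst word) (rule ogs_word_perm_block_word)
    then show ?thesis by (simp flip: map_k add: comp_def del: upt_Suc)
  qed
  ultimately have "ogs_elementary_form n m k (count_list w) (ogs_word_perm w)"
    using assms(1) kin m elementary_word_permutes[OF assms(1)]
    by (auto simp: ogs_elementary_form_def ogs_form_def elementary_word_def)
  then show ?thesis by (auto simp: ogs_elementary_def)
qed

section \<open>Telescoping along the canonical form\<close>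

lemma rho_rec: "j \<le> m \<Longrightarrow> rho m k i j = i (k j) + rho m k i (Suc j)"
  by (simp add: rho_def sum.atLeast_Suc_atMost)

lemma rho_Suc_self [simp]: "rho m k i (Suc m) = 0"
  by (simp add: rho_def)

lemma rho_antimono: "j \<le> l \<Longrightarrow> rho m k i l \<le> rho m k i j"
  unfolding rho_def by (rule sum_mono2) auto

text \<open>
  The partial product of the first q factors on the left exceeds that of the canonical form by
  a surplus t_{k_q}^rho(q+1). The next factor begins with t_{k_q}^(k_q - rho(q+1)), which completes
  the surplus to the full, trivial power, and its second half t_{k_{q+1}}^rho(q+1) splits into the
  wanted power and the next surplus. At q = m the surplus vanishes.
\<close>
lemma ogs_prod_telescope:
  assumes "1 \<le> m" "\<forall>j\<in>{1..m}. 1 \<le> k j \<and> rho m k i 1 \<le> k j"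
  shows "(ogs_gen (k 1) ^^ rho m k i 1) \<odot>
      lr_prod (map (\<lambda>j. (ogs_gen (k (j - 1)) ^^ (k (j - 1) - rho m k i j))
                         \<odot> (ogs_gen (k j) ^^ rho m k i j)) [2..<m+1]) =
    lr_prod (map (\<lambda>j. ogs_gen (k j) ^^ i (k j)) [1..<m+1])"
proof -
  let ?F = "\<lambda>j. (ogs_gen (k (j - 1)) ^^ (k (j - 1) - rho m k i j)) \<odot> (ogs_gen (k j) ^^ rho m k i j)"
  let ?G = "\<lambda>j. ogs_gen (k j) ^^ i (k j)"
  let ?E = "\<lambda>q. ogs_gen (k q) ^^ rho m k i (Suc q)"
  have split: "ogs_gen (k j) ^^ rho m k i j = ?G j \<odot> ?E j" if "j \<le> m" for j
    using that by (simp add: rho_rec funpow_lr_mult)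
  have "(ogs_gen (k 1) ^^ rho m k i 1) \<odot> lr_prod (map ?F [2..<q+1]) =
      lr_prod (map ?G [1..<q+1]) \<odot> ?E q" if "1 \<le> q" "q \<le> m" for q
    using that
  proof (induction q rule: dec_induct)
    case base
    then show ?case using split[of 1] by (simp add: numeral_2_eq_2)
  next
    case (step q)
    have kq: "1 \<le> k q" "rho m k i (Suc q) \<le> k q"
      using assms(2) step rho_antimono[of 1 "Suc q" m k i] by (auto intro: order_trans)
    have "[2..<Suc q + 1] = [2..<q+1] @ [Suc q]" using step by simp
    then have "(ogs_gen (k 1) ^^ rho m k i 1) \<odot> lr_prod (map ?F [2..<Suc q + 1]) =
        ((ogs_gen (k 1) ^^ rho m k i 1) \<odot> lr_prod (map ?F [2..<q+1])) \<odot> ?F (Suc q)"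
      by (simp add: lr_mult_assoc)
    also have "\<dots> = lr_prod (map ?G [1..<q+1]) \<odot> (?E q \<odot> ?F (Suc q))"
      using step by (simp add: lr_mult_assoc del: upt_Suc)
    also have "?E q \<odot> ?F (Suc q) = (ogs_gen (k q) ^^ k q) \<odot> (ogs_gen (k (Suc q)) ^^ rho m k i (Suc q))"
      using kq by (simp flip: lr_mult_assoc add: funpow_lr_mult)
    also have "\<dots> = ?G (Suc q) \<odot> ?E (Suc q)"
      using kq split[of "Suc q"] step by (simp add: ogs_gen_pow_self)
    finally show ?case using step by (simp add: lr_mult_assoc)
  qed
  from this[of m] assms(1) show ?thesis by simp
qed

lemma word_perm_normal_word:
  assumes "1 \<le> m" "strict_mono_on {1..m} k" "\<forall>j\<in>{1..m}. 1 \<le> k j \<and> rho m k i 1 \<le> k j"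
  shows "word_perm (staircase (rho m k i 1) (k 1) (\<lambda>_. rho m k i 1) @
      concat (map (\<lambda>j. staircase (k (j - 1)) (k j) (\<lambda>_. rho m k i j)) [2..<m+1])) =
    lr_prod (map (\<lambda>j. ogs_gen (k j) ^^ i (k j)) [1..<m+1])"
proof -
  have seg: "word_perm (staircase (k (j - 1)) (k j) (\<lambda>_. rho m k i j)) =
      (ogs_gen (k (j - 1)) ^^ (k (j - 1) - rho m k i j)) \<odot> (ogs_gen (k j) ^^ rho m k i j)"
    if "j \<in> set [2..<m+1]" for j
  proof (rule word_perm_staircase_segment)
    have j: "j - 1 \<in> {1..m}" "j \<in> {1..m}" "j - 1 < j" using that by auto
    show "k (j - 1) \<le> k j" using strict_mono_onD[OF assms(2) j] by simp
    show "1 \<le> k (j - 1)" using assms(3) j by blast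
    show "rho m k i j \<le> k (j - 1)"
      using assms(3) j rho_antimono[of 1 j m k i] by (auto intro: order_trans)
  qed
  have "1 \<in> {1..m}" using assms(1) by simp
  then have "word_perm (staircase (rho m k i 1) (k 1) (\<lambda>_. rho m k i 1)) = ogs_gen (k 1) ^^ rho m k i 1"
    using assms(3) by (intro word_perm_staircase_const) auto
  moreover have "map (\<lambda>j. word_perm (staircase (k (j - 1)) (k j) (\<lambda>_. rho m k i j))) [2..<m+1] =
      map (\<lambda>j. (ogs_gen (k (j - 1)) ^^ (k (j - 1) - rho m k i j)) \<odot> (ogs_gen (k j) ^^ rho m k i j))
        [2..<m+1]"
    by (rule map_cong[OF refl]) (rule seg)
  ultimately show ?thesis
    unfolding word_perm_simps word_perm_concat map_map comp_def
      ogs_prod_telescope[OF assms(1,3), symmetric] by (simp only:)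
qed

text \<open>
  Summation by parts: the rows from k_q to k_{q+1} - 1 have rho(q+1) letters each, and the
  differences of successive values of rho are the exponents. The induction carries the boundary
  term k_q rho(q+1), which is zero for q = m.
\<close>
lemma length_normal_word:
  assumes "1 \<le> m" "strict_mono_on {1..m} k" "rho m k i 1 \<le> k 1"
  shows "int (length (staircase (rho m k i 1) (k 1) (\<lambda>_. rho m k i 1) @
      concat (map (\<lambda>j. staircase (k (j - 1)) (k j) (\<lambda>_. rho m k i j)) [2..<m+1]))) =
    (\<Sum>j=1..m. int (k j) * int (i (k j))) - (int (rho m k i 1))\<^sup>2"
proof -
  let ?N = "\<lambda>q. staircase (rho m k i 1) (k 1) (\<lambda>_. rho m k i 1) @
      concat (map (\<lambda>j. staircase (k (j - 1)) (k j) (\<lambda>_. rho m k i j)) [2..<q+1])"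
  have "int (length (?N q)) = (\<Sum>j=1..q. int (k j) * int (i (k j))) - (int (rho m k i 1))\<^sup>2
      + int (k q) * int (rho m k i (Suc q))" if "1 \<le> q" "q \<le> m" for q
    using that
  proof (induction q rule: dec_induct)
    case base
    have "int (length (?N 1)) = (int (k 1) - int (rho m k i 1)) * int (rho m k i 1)"
      using assms(3) by (simp add: length_staircase_const of_nat_diff numeral_2_eq_2)
    then show ?case
      using rho_rec[of 1 m k i] base by (simp add: algebra_simps power2_eq_square)
  next
    case (step q)
    have "[2..<Suc q + 1] = [2..<q+1] @ [Suc q]" using step by simp
    then have "int (length (?N (Suc q))) =
        int (length (?N q)) + int ((k (Suc q) - k q) * rho m k i (Suc q))"
      by (simp add: length_staircase_const del: of_nat_mult)
    also have "int ((k (Suc q) - k q) * rho m k i (Suc q)) =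
        (int (k (Suc q)) - int (k q)) * int (rho m k i (Suc q))"
      using strict_mono_onD[OF assms(2), of q "Suc q"] step by (simp add: of_nat_diff)
    finally show ?case
      using step rho_rec[of "Suc q" m k i] by (simp add: algebra_simps)
  qed
  from this[of m] assms(1) show ?thesis by simp
qed

text \<open>
  The segments of the normal form glue to one staircase over all rows 1, ..., n - 1: rows below
  rho 1 are empty, and a later row u has as many letters as the total exponent of the t_k with
  k > u. This total is rho j between k_{j-1} and k_j and zero from k_m on. No row
  is longer than its index, since nonempty rows begin at rho 1 and rho 1 bounds every total.
\<close>
lemma normal_word_eq_staircase:
  assumes m: "1 \<le> m" and k: "strict_mono_on {1..m} k"
    and rho: "1 \<le> rho m k i 1" "rho m k i 1 \<le> k 1" and n: "k m \<le> n"
  defines "y \<equiv> \<lambda>u. if u < rho m k i 1 then 0 else \<Sum>x | x \<in> {1..m} \<and> u < k x. i (k x)"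
  shows "staircase (rho m k i 1) (k 1) (\<lambda>_. rho m k i 1) @
      concat (map (\<lambda>j. staircase (k (j - 1)) (k j) (\<lambda>_. rho m k i j)) [2..<m+1]) =
    staircase 1 n y"
    and "\<forall>u\<in>{1..<n}. y u \<le> u"
proof -
  let ?r = "rho m k i"
  have k_le: "k a \<le> k b" if "1 \<le> a" "a \<le> b" "b \<le> m" for a b
    using strict_mono_onD[OF k, of a b] that by (cases "a = b") auto
  have y_rho: "y u = ?r j" if "1 \<le> j" "j \<le> m" "?r 1 \<le> u" "u < k j" "\<forall>x. 1 \<le> x \<and> x < j \<longrightarrow> k x \<le> u" for u j
  proof -
    have "{x \<in> {1..m}. u < k x} = {j..m}"
    proof (intro set_eqI iffI)
      fix x assume x: "x \<in> {x \<in> {1..m}. u < k x}"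
      then have "\<not> x < j" using that(5) by fastforce
      then show "x \<in> {j..m}" using x by simp
    next
      fix x assume "x \<in> {j..m}"
      then show "x \<in> {x \<in> {1..m}. u < k x}" using k_le[of j x] that by auto
    qed
    then show ?thesis using that(3) by (simp add: y_def rho_def)
  qed
  have first: "staircase (?r 1) (k 1) y = staircase (?r 1) (k 1) (\<lambda>_. ?r 1)"
    by (rule staircase_cong) (use y_rho[of 1] m in auto)
  have next_seg: "staircase (k q) (k (Suc q)) y = staircase (k q) (k (Suc q)) (\<lambda>_. ?r (Suc q))"
    if q: "1 \<le> q" "q < m" for q
  proof (rule staircase_cong)
    fix u assume u: "k q \<le> u" "u < k (Suc q)"
    have "k x \<le> u" if "1 \<le> x" "x < Suc q" for x
      using k_le[of x q] that q u by simp
    moreover have "?r 1 \<le> u" using rho(2) k_le[of 1 q] q u by simp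
    ultimately show "y u = ?r (Suc q)" using q u by (intro y_rho) auto
  qed
  have "staircase (?r 1) (k q) y = staircase (?r 1) (k 1) (\<lambda>_. ?r 1) @
      concat (map (\<lambda>j. staircase (k (j - 1)) (k j) (\<lambda>_. ?r j)) [2..<q+1])"
    if "1 \<le> q" "q \<le> m" for q
    using that
  proof (induction q rule: dec_induct)
    case base
    then show ?case using first by (simp add: numeral_2_eq_2)
  next
    case (step q)
    have "[2..<Suc q + 1] = [2..<q+1] @ [Suc q]" using step by simp
    moreover have "staircase (?r 1) (k (Suc q)) y =
        staircase (?r 1) (k q) y @ staircase (k q) (k (Suc q)) y"
      using k_le[of 1 q] k_le[of q "Suc q"] rho(2) step by (intro staircase_append) auto
    ultimately show ?case using step next_seg[of q] by simp
  qed
  note upto_m = this[OF m order_refl]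
  have below: "staircase 1 (?r 1) y = []"
    using staircase_cong[of 1 "?r 1" y "\<lambda>_. 0"] by (simp add: y_def staircase_zero)
  have y_above: "y u = 0" if "k m \<le> u" for u
  proof -
    have "{x \<in> {1..m}. u < k x} = {}" using k_le that by fastforce
    then show ?thesis unfolding y_def by (simp only: sum.empty if_cancel)
  qed
  then have above: "staircase (k m) n y = []"
    using staircase_cong[of "k m" n y "\<lambda>_. 0"] by (simp add: staircase_zero)
  have "?r 1 \<le> k m" using rho(2) k_le[of 1 m] m by simp
  then have "staircase 1 n y = staircase 1 (?r 1) y @ staircase (?r 1) (k m) y @ staircase (k m) n y"
    using staircase_append[of 1 "?r 1" n y] staircase_append[of "?r 1" "k m" n y] rho(1) n by simp
  then show "staircase (?r 1) (k 1) (\<lambda>_. ?r 1) @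
      concat (map (\<lambda>j. staircase (k (j - 1)) (k j) (\<lambda>_. ?r j)) [2..<m+1]) = staircase 1 n y"
    using below above upto_m by simp
  have "y u \<le> u" for u
  proof -
    have "(\<Sum>x | x \<in> {1..m} \<and> u < k x. i (k x)) \<le> ?r 1"
      unfolding rho_def by (rule sum_mono2) auto
    then show ?thesis by (simp add: y_def)
  qed
  then show "\<forall>u\<in>{1..<n}. y u \<le> u" by blast
qed

section \<open>Elementary elements\<close>

lemma length_ogs_word: "length (ogs_word m k i) = (\<Sum>j=1..m. i (k j))"
  by (simp add: ogs_word_eq_block_word length_block_word comp_def sum_list_distinct_conv_sum_set
      atLeastLessThanSuc_atLeastAtMost del: upt_Suc)

lemma sum_list_ogs_word: "sum_list (ogs_word m k i) = (\<Sum>j=1..m. k j * i (k j))"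
  by (simp add: ogs_word_eq_block_word sum_list_block_word comp_def sum_list_distinct_conv_sum_set
      atLeastLessThanSuc_atLeastAtMost del: upt_Suc)

lemma ogs_word_perm_ogs_word:
  "ogs_word_perm (ogs_word m k i) = lr_prod (map (\<lambda>j. ogs_gen (k j) ^^ i (k j)) [1..<m+1])"
  by (simp add: ogs_word_eq_block_word ogs_word_perm_block_word comp_def del: upt_Suc)

lemma elementary_word_ogs_word:
  assumes "ogs_elementary_form n m k i p"
  shows "elementary_word n (ogs_word m k i)"
proof -
  have k: "strict_mono_on {1..m} k"
    and bnd: "\<And>j. j \<in> {1..m} \<Longrightarrow> 2 \<le> k j \<and> k j \<le> n \<and> i (k j) < k j"
    and le: "(\<Sum>j=1..m. i (k j)) \<le> k 1"
    using assms by (auto simp: ogs_elementary_form_def ogs_form_def)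
  have k_le: "k a \<le> k b" if "1 \<le> a" "a \<le> b" "b \<le> m" for a b
    using strict_mono_onD[OF k, of a b] that by (cases "a = b") auto
  have "sorted (map k [1..<m+1])"
    using k_le by (auto simp: sorted_iff_nth_mono simp del: upt_Suc)
  moreover have dist: "distinct (map k [1..<m+1])"
    using strict_mono_on_imp_inj_on[OF k]
    by (simp add: distinct_map atLeastLessThanSuc_atLeastAtMost del: upt_Suc)
  moreover have "2 \<le> a \<and> a \<le> n \<and> count_list (ogs_word m k i) a < a \<and> length (ogs_word m k i) \<le> a"
    if "a \<in> set (ogs_word m k i)" for a
  proof -
    have "a \<in> k ` {1..m}"
      using that by (simp add: ogs_word_eq_block_word set_block_word
          atLeastLessThanSuc_atLeastAtMost del: upt_Suc)
    then obtain j where j: "j \<in> {1..m}" "a = k j" by blast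
    moreover have "count_list (ogs_word m k i) a = i a"
      unfolding ogs_word_eq_block_word count_block_word[OF dist] using j
      by (simp add: atLeastLessThanSuc_atLeastAtMost del: upt_Suc)
    ultimately show ?thesis using bnd[OF j(1)] le k_le[of 1 j] by (simp add: length_ogs_word)
  qed
  ultimately show ?thesis
    unfolding elementary_word_def by (simp add: ogs_word_eq_block_word sorted_block_word del: upt_Suc)
qed

text \<open>
  The sum of the letters is additive under concatenation, whereas the square of the length, which is
  subtracted, is strictly superadditive.
\<close>
lemma coxeter_length_append_less:
  assumes "elementary_word n (v @ w)" "v \<noteq> []" "w \<noteq> []"
  shows "coxeter_length n (ogs_word_perm (v @ w)) <
    coxeter_length n (ogs_word_perm v) + coxeter_length n (ogs_word_perm w)"
proof -
  have vw: "elementary_word n v" "elementary_word n w"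
    using assms(1) by (auto intro: elementary_word_sublist)
  have "0 < int (length v) * int (length w)" using assms by simp
  then have "(int (length v))\<^sup>2 + (int (length w))\<^sup>2 < (int (length (v @ w)))\<^sup>2"
    by (simp add: power2_eq_square algebra_simps)
  then show ?thesis
    using coxeter_length_elementary_word[OF assms(1)] coxeter_length_elementary_word[OF vw(1)]
      coxeter_length_elementary_word[OF vw(2)]
    unfolding sum_list_append by linarith
qed

theorem theorem3p23:
  fixes n m :: nat and k i \<pi> :: "nat \<Rightarrow> nat"
  assumes "ogs_elementary_form n m k i \<pi>"
  shows
    "((rho m k i 1 < k 1 \<longrightarrow>
         \<pi> = (ogs_gen (k 1) ^^ rho m k i 1) \<odot>
             lr_prod (map (\<lambda>j. (ogs_gen (k (j - 1)) ^^ (k (j - 1) - rho m k i j))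
                                 \<odot> (ogs_gen (k j) ^^ rho m k i j)) [2..<m+1])) \<and>
      (k 1 = rho m k i 1 \<longrightarrow>
         \<pi> = lr_prod (map (\<lambda>j. (ogs_gen (k (j - 1)) ^^ (k (j - 1) - rho m k i j))
                                 \<odot> (ogs_gen (k j) ^^ rho m k i j)) [2..<m+1])))
     \<and>
     normal_form n \<pi> =
       staircase (rho m k i 1) (k 1) (\<lambda>_. rho m k i 1) @
       concat (map (\<lambda>j. staircase (k (j - 1)) (k j) (\<lambda>_. rho m k i j)) [2..<m+1])
     \<and>
     (int (coxeter_length n \<pi>) =
        (\<Sum>j=1..m. int (k j) * int (i (k j))) - (\<Sum>j=1..m. int (i (k j)))\<^sup>2 \<and>
      int (coxeter_length n \<pi>) =
        (\<Sum>j=1..m. int (k j) * int (i (k j))) - (int (maj n \<pi>))\<^sup>2)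
     \<and>
     ((\<forall>w. w \<noteq> [] \<and> sublist w (ogs_word m k i) \<longrightarrow> ogs_elementary n (ogs_word_perm w)) \<and>
      (\<forall>w1 w2. w1 \<noteq> [] \<and> w2 \<noteq> [] \<and> ogs_word m k i = w1 @ w2 \<longrightarrow>
         coxeter_length n \<pi> = coxeter_length n (ogs_word_perm w1 \<odot> ogs_word_perm w2) \<and>
         coxeter_length n (ogs_word_perm w1 \<odot> ogs_word_perm w2)
           < coxeter_length n (ogs_word_perm w1) + coxeter_length n (ogs_word_perm w2)))
     \<and>
     ((\<forall>r\<in>{1..n-1}.
         int (coxeter_length n (adj r \<odot> \<pi>)) =
           (if r = (\<Sum>j=1..m. i (k j)) then int (coxeter_length n \<pi>) - 1
            else int (coxeter_length n \<pi>) + 1)) \<and>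
      descents n \<pi> = {maj n \<pi>})"
proof -
  define w where "w = ogs_word m k i"
  define N where "N = staircase (rho m k i 1) (k 1) (\<lambda>_. rho m k i 1) @
      concat (map (\<lambda>j. staircase (k (j - 1)) (k j) (\<lambda>_. rho m k i j)) [2..<m+1])"
  have m: "1 \<le> m" and k: "strict_mono_on {1..m} k" and perm: "\<pi> permutes {1..n}"
    and bnd: "\<forall>j\<in>{1..m}. 2 \<le> k j \<and> k j \<le> n \<and> 0 < i (k j) \<and> i (k j) < k j"
    and \<pi>: "\<pi> = lr_prod (map (\<lambda>j. ogs_gen (k j) ^^ i (k j)) [1..<m+1])"
    and rho_le: "rho m k i 1 \<le> k 1"
    using assms unfolding ogs_elementary_form_def ogs_form_def rho_def by blast+
  have one: "1 \<in> {1..m}" and last: "m \<in> {1..m}" using m by auto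
  have rho_le_all: "\<forall>j\<in>{1..m}. 1 \<le> k j \<and> rho m k i 1 \<le> k j"
  proof
    fix j assume j: "j \<in> {1..m}"
    then have "k 1 \<le> k j" using strict_mono_onD[OF k one j] by (cases "j = 1") auto
    moreover have "2 \<le> k j" using bnd j by blast
    ultimately show "1 \<le> k j \<and> rho m k i 1 \<le> k j" using rho_le by simp
  qed
  have w: "elementary_word n w" unfolding w_def by (rule elementary_word_ogs_word[OF assms])
  have w_perm: "ogs_word_perm w = \<pi>" by (simp add: w_def \<pi> ogs_word_perm_ogs_word del: upt_Suc)
  have w_len: "length w = rho m k i 1" by (simp add: w_def length_ogs_word rho_def)
  have rho_pos: "1 \<le> rho m k i 1"
  proof -
    have "0 < i (k 1)" using bnd one by blast
    then show ?thesis using rho_rec[OF m, of k i] by simp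
  qed
  then have w_ne: "w \<noteq> []" using w_len by auto
  have desc: "descents n \<pi> = {rho m k i 1}"
    using descents_elementary_word[OF w w_ne] by (simp add: w_perm w_len)
  then have maj: "maj n \<pi> = rho m k i 1" by (simp add: maj_def)
  have len: "int (coxeter_length n \<pi>) =
      (\<Sum>j=1..m. int (k j) * int (i (k j))) - (int (rho m k i 1))\<^sup>2"
    using coxeter_length_elementary_word[OF w]
    by (simp add: w_perm w_len) (simp add: w_def sum_list_ogs_word)

  have "rho m k i 1 < k 1 \<longrightarrow>
         \<pi> = (ogs_gen (k 1) ^^ rho m k i 1) \<odot>
             lr_prod (map (\<lambda>j. (ogs_gen (k (j - 1)) ^^ (k (j - 1) - rho m k i j))
                                 \<odot> (ogs_gen (k j) ^^ rho m k i j)) [2..<m+1])"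
    unfolding ogs_prod_telescope[OF m rho_le_all] \<pi> by (rule impI refl)+
  moreover have "k 1 = rho m k i 1 \<longrightarrow>
         \<pi> = lr_prod (map (\<lambda>j. (ogs_gen (k (j - 1)) ^^ (k (j - 1) - rho m k i j))
                                 \<odot> (ogs_gen (k j) ^^ rho m k i j)) [2..<m+1])"
  proof
    assume eq: "k 1 = rho m k i 1"
    have "1 \<le> k 1" using rho_le_all one by blast
    then have "ogs_gen (k 1) ^^ rho m k i 1 = id" unfolding eq[symmetric] by (rule ogs_gen_pow_self)
    then show "\<pi> = lr_prod (map (\<lambda>j. (ogs_gen (k (j - 1)) ^^ (k (j - 1) - rho m k i j))
                                 \<odot> (ogs_gen (k j) ^^ rho m k i j)) [2..<m+1])"
      using ogs_prod_telescope[OF m rho_le_all] unfolding \<pi>[symmetric] by simp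
  qed
  moreover have "normal_form n \<pi> = N"
  proof -
    have "k m \<le> n" using bnd last by blast
    from normal_word_eq_staircase[OF m k rho_pos rho_le this]
    obtain y where y: "N = staircase 1 n y" "\<forall>u\<in>{1..<n}. y u \<le> u" unfolding N_def by blast
    have "length N = coxeter_length n \<pi>"
      using length_normal_word[OF m k rho_le] len unfolding N_def by linarith
    moreover have "word_perm N = \<pi>"
      unfolding N_def \<pi> by (rule word_perm_normal_word[OF m k rho_le_all])
    ultimately have "reduced_word n \<pi> (staircase 1 n y)"
      using set_staircase[of 1 n y] y by (simp add: reduced_word_def)
    then show ?thesis unfolding y(1) using y(2) by (rule normal_form_eqI)
  qed
  moreover have "int (coxeter_length n \<pi>) =
      (\<Sum>j=1..m. int (k j) * int (i (k j))) - (\<Sum>j=1..m. int (i (k j)))\<^sup>2"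
    using len by (simp add: rho_def)
  moreover have "int (coxeter_length n \<pi>) =
      (\<Sum>j=1..m. int (k j) * int (i (k j))) - (int (maj n \<pi>))\<^sup>2"
    using len by (simp add: maj)
  moreover have "\<forall>v. v \<noteq> [] \<and> sublist v (ogs_word m k i) \<longrightarrow> ogs_elementary n (ogs_word_perm v)"
    using elementary_word_sublist[OF w] ogs_elementary_elementary_word unfolding w_def by blast
  moreover have "\<forall>w1 w2. w1 \<noteq> [] \<and> w2 \<noteq> [] \<and> ogs_word m k i = w1 @ w2 \<longrightarrow>
         coxeter_length n \<pi> = coxeter_length n (ogs_word_perm w1 \<odot> ogs_word_perm w2) \<and>
         coxeter_length n (ogs_word_perm w1 \<odot> ogs_word_perm w2)
           < coxeter_length n (ogs_word_perm w1) + coxeter_length n (ogs_word_perm w2)"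
  proof (intro allI impI)
    fix w1 w2 assume "w1 \<noteq> [] \<and> w2 \<noteq> [] \<and> ogs_word m k i = w1 @ w2"
    then show "coxeter_length n \<pi> = coxeter_length n (ogs_word_perm w1 \<odot> ogs_word_perm w2) \<and>
         coxeter_length n (ogs_word_perm w1 \<odot> ogs_word_perm w2)
           < coxeter_length n (ogs_word_perm w1) + coxeter_length n (ogs_word_perm w2)"
      using coxeter_length_append_less[of n w1 w2] w w_perm by (simp add: w_def)
  qed
  moreover have "\<forall>r\<in>{1..n-1}. int (coxeter_length n (adj r \<odot> \<pi>)) =
           (if r = (\<Sum>j=1..m. i (k j)) then int (coxeter_length n \<pi>) - 1
            else int (coxeter_length n \<pi>) + 1)"
  proof
    fix r assume "r \<in> {1..n-1}"
    then have "1 \<le> r" "r < n" by auto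
    then show "int (coxeter_length n (adj r \<odot> \<pi>)) =
           (if r = (\<Sum>j=1..m. i (k j)) then int (coxeter_length n \<pi>) - 1
            else int (coxeter_length n \<pi>) + 1)"
      using coxeter_length_adj[OF perm, of r] by (simp add: desc rho_def)
  qed
  moreover have "descents n \<pi> = {maj n \<pi>}" by (simp add: desc maj)
  ultimately show ?thesis unfolding N_def by (intro conjI)
qed

end
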